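(* Let $R$ be a 2-Henselian valuation ring such that $2\in R^{*}$, and let $M$, $N$, and $L$ be three $R$-lattices. If $M\oplus L\cong N\oplus L$ (orthogonal direct sums), then $M\cong N$.
   Context: A valuation ring $R$ is an integral domain with fraction field $\mathbb{K}$, together with a totally ordered abelian group $\Gamma$ (additive, arbitrary rank) and a surjective homomorphism $v:\mathbb{K}^{*}\to\Gamma$ satisfying $v(x+y)\geq\min\{v(x),v(y)\}$, extended by $v(0)=\infty$, such that $R=\{x\in\mathbb{K}: v(x)\geq0\}$. $I_{0}=\{x: v(x)>0\}$ is its maximal ideal. $R$ is 2-Henselian if $2\neq0$ in $R$ and for every monic $f\in R[x]$ of degree 2 and every $a\in R$ with $v(f(a))>0$ and $v(f'(a))=0$ there is a root $b\in R$ of $f$ with $b-a\in I_{0}$. An $R$-lattice is a free $R$-module $M$ of finite rank with a symmetric bilinear form $(\cdot,\cdot):M\times M\to R$ which is non-degenerate, i.e. the induced map $M\to \mathrm{Hom}_{R}(M,R)$ is injective. Isomorphisms of lattices are $R$-module isomorphisms preserving the bilinear forms. *)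

theory Defs
  imports
    "HOL-Analysis.Product_Vector"
    "HOL-Computational_Algebra.Polynomial_Factorial"
    "HOL-Library.Extended"
begin

text \<open>
  The ring \<open>R\<close> is the type \<open>'r\<close>, its fraction field is \<open>'r fract\<close>, and \<open>R\<close> is identified with
  the range of \<^const>\<open>to_fract\<close>. The value of a valuation \<open>v\<close> at \<open>0\<close> carries no
  information; \<open>ext_val v\<close> is the extension by \<open>v(0) = \<infinity>\<close>. Only the values \<^const>\<open>Fin\<close> and
  \<^const>\<open>Pinf\<close> of \<open>'g extended\<close> occur.
\<close>

definition ext_val :: "('r::idom fract \<Rightarrow> 'g::linordered_ab_group_add) \<Rightarrow> 'r fract \<Rightarrow> 'g extended"
  where "ext_val v x = (if x = 0 then Pinf else Fin (v x))"

locale valuation_ring =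
  fixes v :: "'r::idom fract \<Rightarrow> 'g::linordered_ab_group_add"
  assumes val_mult: "x \<noteq> 0 \<Longrightarrow> y \<noteq> 0 \<Longrightarrow> v (x * y) = v x + v y"
    and val_surj: "v ` (UNIV - {0}) = UNIV"
    and val_add: "min (ext_val v x) (ext_val v y) \<le> ext_val v (x + y)"
    and ring_eq: "range to_fract = {x. 0 \<le> ext_val v x}"

locale two_henselian_valuation_ring = valuation_ring v
  for v :: "'r::idom fract \<Rightarrow> 'g::linordered_ab_group_add" +
  assumes two_neq_zero: "(2::'r) \<noteq> 0"
    and hensel:
      "\<lbrakk>lead_coeff f = 1; degree f = 2;
        ext_val v (to_fract (poly f a)) > 0; ext_val v (to_fract (poly (pderiv f) a)) = 0\<rbrakk>
       \<Longrightarrow> \<exists>b. poly f b = 0 \<and> ext_val v (to_fract (b - a)) > 0"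

text \<open>
  The assumption \<open>form_hom\<close> together with symmetry is bilinearity; it also says that
  \<open>x \<mapsto> form x\<close> maps \<open>M\<close> to \<open>Hom(M, R)\<close>, and non-degeneracy is the injectivity of this map.
\<close>

locale R_lattice = module scale
  for scale :: "'r::idom \<Rightarrow> 'm::ab_group_add \<Rightarrow> 'm" +
  fixes form :: "'m \<Rightarrow> 'm \<Rightarrow> 'r"
  assumes free_finite_rank: "\<exists>B. finite B \<and> independent B \<and> span B = UNIV"
    and form_sym: "form x y = form y x"
    and form_hom: "module_hom scale (*) (form x)"
    and nondegenerate: "inj form"

definition lattice_iso ::
  "('r::idom \<Rightarrow> 'm::ab_group_add \<Rightarrow> 'm) \<Rightarrow> ('m \<Rightarrow> 'm \<Rightarrow> 'r) \<Rightarrow>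
   ('r \<Rightarrow> 'n::ab_group_add \<Rightarrow> 'n) \<Rightarrow> ('n \<Rightarrow> 'n \<Rightarrow> 'r) \<Rightarrow> bool"
  where "lattice_iso sM bM sN bN \<longleftrightarrow>
    (\<exists>\<phi>. module_hom sM sN \<phi> \<and> bij \<phi> \<and> (\<forall>x y. bN (\<phi> x) (\<phi> y) = bM x y))"

definition orth_sum_form ::
  "('m \<Rightarrow> 'm \<Rightarrow> 'r::idom) \<Rightarrow> ('n \<Rightarrow> 'n \<Rightarrow> 'r) \<Rightarrow> 'm \<times> 'n \<Rightarrow> 'm \<times> 'n \<Rightarrow> 'r"
  where "orth_sum_form bM bN x y = bM (fst x) (fst y) + bN (snd x) (snd y)"

end

theory Submission
  imports Defs
begin

text \<open>
  Witt's proof of cancellation over a field uses an orthogonal basis and reflections. It works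
  over \<open>R\<close> because of two facts: divisibility in \<open>R\<close> is a total preorder, and \<open>2\<close> is a unit.

  Among the norms \<open>(x, x)\<close> of generators and of sums of two generators of \<open>L\<close>, one divides all the
  others. By polarization it divides all values of the form, so its vector splits off orthogonally;
  repeating this yields orthogonal generators of \<open>L\<close> (\<open>exists_orthogonal_generators\<close>). By
  non-degeneracy the nonzero ones have nonzero norms \<open>c\<^sub>i\<close>, and \<open>c\<^sub>i\<close> divides every product with
  the \<open>i\<close>-th generator.

  Let \<open>x\<close>, \<open>y\<close> have the same norm \<open>c \<noteq> 0\<close>, where \<open>c\<close> divides all products with \<open>x\<close> and with
  \<open>y\<close>, and write \<open>(x, y) = c t\<close>. The norms of \<open>x - y\<close> and \<open>x + y\<close> are \<open>2 c (1 - t)\<close> and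
  \<open>2 c (1 + t)\<close>. As \<open>1 - t\<close> and \<open>1 + t\<close> have the sum \<open>2\<close>, one of them is a unit, and then the
  corresponding reflection is defined over \<open>R\<close> and moves \<open>x\<close> to \<open>y\<close> or to \<open>- y\<close>; in the
  second case the reflection in \<open>y\<close> corrects the sign. All reflections involved fix the vectors
  orthogonal to \<open>x\<close> and \<open>y\<close>, so orthogonal families can be moved one vector at a time
  (\<open>exists_isometry_extending\<close>).

  Given an isomorphism \<open>\<phi>\<close> from \<open>M \<oplus> L\<close> to \<open>N \<oplus> L\<close>, this provides an isometry of \<open>N \<oplus> L\<close> that
  carries \<open>\<phi>\<close> of each orthogonal generator of \<open>L\<close> back to that generator. The composite is the
  identity on \<open>L\<close>, hence it maps the orthogonal complement \<open>M\<close> of \<open>L\<close> onto the complement \<open>N\<close>.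
\<close>

section \<open>Divisibility in the ring\<close>

text \<open>
  The quotients \<open>a / b\<close> and \<open>b / a\<close> have opposite values, so one of them lies in the ring.
\<close>

lemma (in valuation_ring) dvd_total:
  fixes a b :: 'r
  shows "a dvd b \<or> b dvd a"
proof (cases "a = 0 \<or> b = 0")
  case True
  then show ?thesis by auto
next
  case False
  define A B where "A = to_fract a" and "B = to_fract b"
  have A: "A \<noteq> 0" and B: "B \<noteq> 0"
    using False by (simp_all add: A_def B_def)
  have dvd_if_nonneg: "c dvd d" if nz: "to_fract c \<noteq> 0" "to_fract d \<noteq> 0"
    and val: "0 \<le> v (to_fract d / to_fract c)" for c d :: 'r
  proof -
    have "0 \<le> ext_val v (to_fract d / to_fract c)"
      using val by (simp add: ext_val_def zero_extended_def)
    then have "to_fract d / to_fract c \<in> range to_fract"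
      by (simp only: ring_eq mem_Collect_eq)
    then obtain e where "to_fract d / to_fract c = to_fract e" by blast
    then have "to_fract d = to_fract e * to_fract c"
      by (metis nonzero_divide_eq_eq nz(1))
    then have "d = e * c"
      by (metis to_fract_eq_iff to_fract_mult)
    then show ?thesis by simp
  qed
  have "v 1 = v 1 + v 1"
    using val_mult[of 1 1] by (simp only: mult_1_right) (metis one_neq_zero)
  moreover have "v (A / B * (B / A)) = v (A / B) + v (B / A)"
    by (rule val_mult) (simp_all add: A B)
  moreover have "A / B * (B / A) = 1"
    by (simp add: A B)
  ultimately have sum: "v (A / B) + v (B / A) = 0"
    by (metis add_cancel_right_right)
  have "0 \<le> v (A / B) \<or> 0 \<le> v (B / A)"
  proof (rule ccontr)
    assume "\<not> (0 \<le> v (A / B) \<or> 0 \<le> v (B / A))"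
    then have "v (A / B) + v (B / A) < 0"
      by (intro add_neg_neg) (simp_all only: not_le de_Morgan_disj)
    then show False by (simp add: sum)
  qed
  then show ?thesis
    using dvd_if_nonneg A B by (auto simp: A_def B_def)
qed

lemma finite_has_common_divisor_member:
  fixes N :: "'a::comm_monoid_mult set"
  assumes "finite N" "N \<noteq> {}" and total: "\<And>a b :: 'a. a dvd b \<or> b dvd a"
  shows "\<exists>d\<in>N. \<forall>x\<in>N. d dvd x"
  using assms(1,2)
proof (induction N rule: finite_ne_induct)
  case (singleton x)
  then show ?case by simp
next
  case (insert x F)
  then obtain d where d: "d \<in> F" "\<forall>y\<in>F. d dvd y" by blast
  from total[of x d] show ?case
  proof
    assume "x dvd d"
    then have "\<forall>y\<in>insert x F. x dvd y"
      using d(2) by (auto intro: dvd_trans)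
    then show ?thesis by blast
  next
    assume "d dvd x"
    then show ?thesis using d by blast
  qed
qed

section \<open>Modules with a symmetric bilinear form\<close>

locale symmetric_form = module scale
  for scale :: "'r::idom \<Rightarrow> 'm::ab_group_add \<Rightarrow> 'm" +
  fixes form :: "'m \<Rightarrow> 'm \<Rightarrow> 'r"
  assumes form_sym: "form x y = form y x"
    and form_hom: "module_hom scale (*) (form x)"
begin

lemma form_add_right: "form x (y + z) = form x y + form x z"
  using form_hom by (simp add: module_hom_iff)

lemma form_scale_right: "form x (scale a y) = a * form x y"
  using form_hom by (simp add: module_hom_iff)

lemma form_add_left: "form (y + z) x = form y x + form z x"
  by (metis form_add_right form_sym)

lemma form_scale_left: "form (scale a y) x = a * form y x"
  by (metis form_scale_right form_sym)

lemma form_zero_right: "form x 0 = 0"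
  using form_scale_right[of x 0 0] by simp

lemma form_zero_left: "form 0 x = 0"
  by (metis form_zero_right form_sym)

lemma form_minus_right: "form x (- y) = - form x y"
  using form_add_right[of x y "- y"] by (simp add: form_zero_right add_eq_0_iff)

lemma form_minus_left: "form (- y) x = - form y x"
  by (metis form_minus_right form_sym)

lemma form_diff_right: "form x (y - z) = form x y - form x z"
  using form_add_right[of x y "- z"] by (simp add: form_minus_right)

lemma form_diff_left: "form (y - z) x = form y x - form z x"
  by (metis form_diff_right form_sym)

lemmas form_simps =
  form_add_right form_scale_right form_add_left form_scale_left form_zero_right form_zero_left
  form_minus_right form_minus_left form_diff_right form_diff_left

definition isometry :: "('m \<Rightarrow> 'm) \<Rightarrow> bool"
  where "isometry s \<longleftrightarrow>
    module_hom scale scale s \<and> bij s \<and> (\<forall>x y. form (s x) (s y) = form x y)"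

lemma isometry_id: "isometry id"
  by (simp add: isometry_def module_hom_id)

lemma isometry_comp: "isometry s \<Longrightarrow> isometry t \<Longrightarrow> isometry (s \<circ> t)"
  by (auto simp: isometry_def intro: module_hom_compose bij_comp)

text \<open>
  The reflection in \<open>u\<close> subtracts \<open>2 (u, z) / (u, u)\<close> times \<open>u\<close> from \<open>z\<close>. The divisibility
  assumption makes this quotient an element of the ring. The conclusion speaks of any \<open>k\<close> with
  \<open>2 (u, z) = k (u, u)\<close>, so that values of \<open>s\<close> can be read off without a division operation.
\<close>

lemma exists_reflection:
  assumes u0: "form u u \<noteq> 0" and dvd: "\<And>z. form u u dvd 2 * form u z"
  obtains s where "isometry s"
    and "\<And>z k. 2 * form u z = k * form u u \<Longrightarrow> s z = z - scale k u"
proof -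
  obtain q where q: "\<And>z. 2 * form u z = form u u * q z"
    using dvd unfolding dvd_def by metis
  have quot_eq: "q z = k" if "2 * form u z = k * form u u" for z k
  proof -
    have "form u u * q z = form u u * k"
      unfolding q[symmetric] that by (rule mult.commute)
    then show ?thesis using u0 by simp
  qed
  have q_add: "q (x + y) = q x + q y" for x y
  proof (rule quot_eq)
    have "2 * form u (x + y) = 2 * form u x + 2 * form u y"
      by (simp add: form_simps distrib_left)
    then show "2 * form u (x + y) = (q x + q y) * form u u"
      unfolding q by (simp add: algebra_simps)
  qed
  have q_scale: "q (scale a x) = a * q x" for a x
  proof (rule quot_eq)
    have "2 * form u (scale a x) = a * (2 * form u x)"
      by (simp add: form_simps)
    then show "2 * form u (scale a x) = a * q x * form u u"
      unfolding q by (simp add: ac_simps)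
  qed
  have q_u: "q u = 2"
    by (rule quot_eq) simp
  define s where "s z = z - scale (q z) u" for z
  have hom: "module_hom scale scale s"
    unfolding module_hom_iff
    by (auto simp: s_def q_add q_scale algebra_simps module_axioms)
  then interpret s: module_hom scale scale s .
  have s_u: "s u = - u"
    using scale_left_distrib[of 1 1 u] by (simp add: s_def q_u)
  have "s (s z) = z" for z
  proof -
    have "s (s z) = s z - scale (q z) (s u)"
      by (simp add: s_def[of z] s.diff s.scale)
    also have "\<dots> = z"
      by (simp add: s_u) (simp add: s_def)
    finally show ?thesis .
  qed
  then have bij: "bij s"
    by (rule involuntory_imp_bij)
  have form_eq: "form (s x) (s y) = form x y" for x y
  proof -
    have "form u u * (q x * q y * form u u) = (2 * form u x) * (2 * form u y)"
      unfolding q by (simp add: ac_simps)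
    also have "\<dots> = (2 * form u y) * form u x + (2 * form u x) * form u y"
      by (simp add: algebra_simps)
    also have "\<dots> = form u u * (q y * form u x + q x * form u y)"
      unfolding q by (simp add: algebra_simps)
    finally have "q x * q y * form u u = q y * form u x + q x * form u y"
      using u0 by simp
    then show ?thesis
      by (simp add: s_def form_simps form_sym[of x u] algebra_simps)
  qed
  show ?thesis
  proof
    show "isometry s" using hom bij form_eq by (simp add: isometry_def)
    show "s z = z - scale k u" if "2 * form u z = k * form u u" for z k
      using quot_eq[OF that] by (simp add: s_def)
  qed
qed

end

section \<open>Orthogonal generators\<close>

text \<open>
  From here on only two properties of the ring enter: it is a chain ring, that is, any two elements
  are comparable under divisibility, and \<open>2\<close> is a unit.
\<close>

locale chain_ring_form = symmetric_form scale form
  for scale :: "'r::idom \<Rightarrow> 'm::ab_group_add \<Rightarrow> 'm" and form :: "'m \<Rightarrow> 'm \<Rightarrow> 'r" +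
  assumes dvd_total: "(a::'r) dvd b \<or> b dvd a"
    and two_unit: "(2::'r) dvd 1"
begin

lemma two_neq_zero: "(2::'r) \<noteq> 0"
  using two_unit by auto

lemma dvd_two_mult_cancel: "d dvd a" if "d dvd 2 * a" for d a :: 'r
proof -
  from two_unit obtain h :: 'r where "1 = 2 * h" by blast
  then have "a = h * (2 * a)"
    by (metis mult.assoc mult.commute mult_1)
  then show ?thesis
    using that by (metis dvd_mult)
qed

text \<open>
  Replacing a suitable generator \<open>u\<close> by \<open>x\<close> gives a generator whose norm divides its product with
  every vector. The norms of the generators may all vanish while some \<open>(u, w)\<close> does not, as in a
  hyperbolic plane, so sums \<open>u + w\<close> have to compete as well; then by polarization the
  chosen norm divides \<open>2 (u, w)\<close>, hence \<open>(u, w)\<close>.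
\<close>

lemma exists_pivot:
  assumes fin: "finite B" and ne: "B \<noteq> {}"
  shows "\<exists>u\<in>B. \<exists>x. span (insert x (B - {u})) = span B \<and>
    (\<forall>p\<in>span B. form x x dvd form x p)"
proof -
  \<comment> \<open>The summand \<open>0\<close> puts the generators themselves into \<open>S\<close>.\<close>
  define S where "S = (\<Union>u\<in>B. (\<lambda>w. u + w) ` insert 0 (B - {u}))"
  have "finite S" "S \<noteq> {}"
    using fin ne by (auto simp: S_def)
  then obtain x where x: "x \<in> S" and min: "\<forall>s\<in>S. form x x dvd form s s"
    using finite_has_common_divisor_member[of "(\<lambda>s. form s s) ` S"] dvd_total by auto
  obtain u w where u: "u \<in> B" and w: "w \<in> insert 0 (B - {u})" and x_eq: "x = u + w"
    using x unfolding S_def by blast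
  have "x - u \<in> span (B - {u})"
    using w by (auto simp: x_eq span_zero intro: span_base)
  then have "span (insert x (B - {u})) = span (insert u (B - {u}))"
    by (rule eq_span_insert_eq)
  then have span_eq: "span (insert x (B - {u})) = span B"
    using u by (simp add: insert_absorb)
  have diag: "form x x dvd form p p" if "p \<in> B" for p
  proof -
    have "p \<in> S" using that by (force simp: S_def)
    then show ?thesis using min by blast
  qed
  have gen: "form x x dvd form p r" if p: "p \<in> B" and r: "r \<in> B" for p r
  proof (cases "p = r")
    case True
    then show ?thesis using diag p by simp
  next
    case False
    then have "p + r \<in> S" using p r by (auto simp: S_def)
    then have "form x x dvd form (p + r) (p + r) - form p p - form r r"
      using min diag p r by (intro dvd_diff) auto
    also have "form (p + r) (p + r) - form p p - form r r = 2 * form p r"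
      by (simp add: form_simps form_sym[of r p])
    finally show ?thesis by (rule dvd_two_mult_cancel)
  qed
  have right: "form x x dvd form p r" if p: "p \<in> B" and r: "r \<in> span B" for p r
    using r by (induction rule: span_induct_alt) (auto simp: form_simps gen p)
  have "form x x dvd form r p" if r: "r \<in> span B" and p: "p \<in> span B" for p r
    using r by (induction rule: span_induct_alt) (auto simp: form_simps right p)
  moreover have "x \<in> span B"
    using span_eq span_base[of x "insert x (B - {u})"] by simp
  ultimately show ?thesis
    using u span_eq by blast
qed

text \<open>
  This is Gram-Schmidt with the pivot of \<open>exists_pivot\<close>: the other generators are projected to the
  orthogonal complement of the pivot \<open>x\<close>, and the induction continues there. Counting generators,
  instead of working with bases, avoids any discussion of linear independence.
\<close>

lemma exists_orthogonal_generators: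
  assumes "finite B"
  shows "\<exists>E. finite E \<and> span E = span B \<and> pairwise (\<lambda>e f. form e f = 0) E"
  using assms
proof (induction "card B" arbitrary: B rule: less_induct)
  case less
  show ?case
  proof (cases "B = {}")
    case True
    then show ?thesis by (intro exI[of _ "{}"]) simp
  next
    case False
    then obtain u x where u: "u \<in> B" and span_x: "span (insert x (B - {u})) = span B"
      and dvd: "\<And>p. p \<in> span B \<Longrightarrow> form x x dvd form x p"
      using exists_pivot[OF less.prems] by blast
    have "\<forall>p\<in>B. \<exists>k. form x p = form x x * k"
      using dvd span_base by (blast elim: dvdE)
    then obtain q where q: "\<And>p. p \<in> B \<Longrightarrow> form x p = form x x * q p"
      by metis
    define B' where "B' = (\<lambda>p. p - scale (q p) x) ` (B - {u})"
    have fin': "finite B'" using less.prems by (simp add: B'_def)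
    have "card B' \<le> card (B - {u})"
      using less.prems by (simp add: B'_def card_image_le)
    also have "\<dots> < card B"
      using u less.prems by (rule card_Diff1_less[rotated])
    finally obtain E where E: "finite E" "span E = span B'"
        "pairwise (\<lambda>e f. form e f = 0) E"
      using less.hyps fin' by blast
    have orth: "form x p = 0" if "p \<in> span B'" for p
      using that by (induction rule: span_induct_alt) (auto simp: B'_def form_simps q)
    have "span (insert x E) = span (insert x B')"
      by (simp add: span_insert E)
    also have "\<dots> = span (insert x (B - {u}))"
      unfolding span_eq
    proof (intro conjI subsetI)
      fix y assume "y \<in> insert x B'"
      then show "y \<in> span (insert x (B - {u}))"
        by (auto simp: B'_def intro!: span_diff span_scale intro: span_base)
    next
      fix y assume "y \<in> insert x (B - {u})"
      then show "y \<in> span (insert x B')"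
      proof
        assume "y \<in> B - {u}"
        then have "y - scale (q y) x \<in> span B'"
          by (auto simp: B'_def intro: span_base)
        then show ?thesis by (auto simp: span_insert)
      qed (auto intro: span_base)
    qed
    finally have span_eq: "span (insert x E) = span B" using span_x by simp
    have "form x e = 0" "form e x = 0" if "e \<in> E" for e
      using orth[of e] form_sym[of x e] span_base[OF that] by (simp_all add: E(2))
    then have "pairwise (\<lambda>e f. form e f = 0) (insert x E)"
      using E(3) by (simp add: pairwise_insert)
    then show ?thesis
      using E(1) span_eq by blast
  qed
qed

section \<open>Extending isometries\<close>

text \<open>
  The element that divides the other one also divides their sum, which is a unit.
\<close>

lemma unit_of_sum_two:
  fixes a b :: 'r
  assumes "a + b = 2"
  shows "a dvd 1 \<or> b dvd 1"
  using dvd_total[of a b] assms two_unit by (metis dvd_add dvd_refl dvd_trans)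

text \<open>
  The reflection in \<open>x - y\<close> or in \<open>x + y\<close> does this, the latter followed by the reflection in
  \<open>y\<close>. Besides \<open>s x = y\<close> it matters that the common orthogonal complement of \<open>x\<close> and \<open>y\<close> is fixed:
  this lets several vectors be moved one after the other.
\<close>

lemma exists_isometry_moving_vector:
  assumes norm: "form x x = c" "form y y = c" and c0: "c \<noteq> 0"
    and dvd: "\<And>z. c dvd form x z" "\<And>z. c dvd form y z"
  obtains s where "isometry s" and "s x = y"
    and "\<And>z. form x z = 0 \<Longrightarrow> form y z = 0 \<Longrightarrow> s z = z"
proof -
  note found = that
  \<comment> \<open>The sign \<open>e\<close> treats \<open>x - y\<close> and \<open>x + y\<close> at once.\<close>
  have reflect: thesis
    if e: "e = 1 \<or> e = -1" and unit: "(1 - e * t) dvd 1" and t: "form x y = c * t" for e t :: 'r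
  proof -
    define u where "u = x - scale e y"
    have uu: "form u u = 2 * c * (1 - e * t)"
      using e t by (auto simp: u_def form_simps norm form_sym[of y x] algebra_simps)
    have ux: "2 * form u x = 1 * form u u"
      unfolding uu by (simp add: u_def form_simps norm form_sym[of y x] t algebra_simps)
    have "form u u \<noteq> 0"
      using uu c0 two_neq_zero unit by auto
    moreover have "form u u dvd 2 * form u z" for z
    proof -
      have "c dvd form u z"
        by (simp add: u_def form_simps dvd)
      then have "2 * c * (1 - e * t) dvd 2 * form u z * 1"
        using unit by (intro mult_dvd_mono) auto
      then show ?thesis by (simp add: uu)
    qed
    ultimately obtain s where s: "isometry s"
      and s_eq: "\<And>z k. 2 * form u z = k * form u u \<Longrightarrow> s z = z - scale k u"
      using exists_reflection by blast
    have sx: "s x = scale e y"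
      using s_eq[OF ux] by (simp add: u_def)
    have s_fix: "s z = z" if "form x z = 0" "form y z = 0" for z
      using s_eq[of z 0] that by (simp add: u_def form_simps)
    from e show thesis
    proof
      assume "e = 1"
      then show thesis using found[OF s] sx s_fix by simp
    next
      assume e: "e = -1"
      have "form y y \<noteq> 0" "\<And>z. form y y dvd 2 * form y z"
        using norm c0 dvd by simp_all
      then obtain r where r: "isometry r"
        and r_eq: "\<And>z k. 2 * form y z = k * form y y \<Longrightarrow> r z = z - scale k y"
        using exists_reflection by blast
      have "r (- y) = - y - scale (- 2) y"
        by (rule r_eq) (simp add: form_simps)
      also have "\<dots> = y"
        using scale_left_distrib[of 1 1 y] by simp
      finally have "r (s x) = y" using sx e by simp
      moreover have "r (s z) = z" if "form x z = 0" "form y z = 0" for z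
        using r_eq[of z 0] s_fix that by simp
      ultimately show thesis
        using found[OF isometry_comp[OF r s]] by simp
    qed
  qed
  obtain t where "form x y = c * t"
    using dvd by blast
  moreover have "(1 - t) dvd 1 \<or> (1 + t) dvd 1"
    by (rule unit_of_sum_two) simp
  ultimately show thesis
    using reflect[of 1 t] reflect[of "-1" t] by auto
qed

text \<open>
  When the first vectors are already in place, the next one can be moved without disturbing them:
  its current position and its target are both orthogonal to them.
\<close>

lemma exists_isometry_extending:
  assumes "finite I"
    and "\<And>i. i \<in> I \<Longrightarrow> form (x i) (x i) = c i" "\<And>i. i \<in> I \<Longrightarrow> form (y i) (y i) = c i"
    and "\<And>i. i \<in> I \<Longrightarrow> c i \<noteq> 0"
    and "\<And>i z. i \<in> I \<Longrightarrow> c i dvd form (x i) z" "\<And>i z. i \<in> I \<Longrightarrow> c i dvd form (y i) z"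
    and "pairwise (\<lambda>i j. form (x i) (x j) = 0) I" "pairwise (\<lambda>i j. form (y i) (y j) = 0) I"
  shows "\<exists>s. isometry s \<and> (\<forall>i\<in>I. s (x i) = y i)"
  using assms
proof (induction I rule: finite_induct)
  case empty
  then show ?case using isometry_id by blast
next
  case (insert k I)
  then obtain s where s: "isometry s" and sx: "\<And>i. i \<in> I \<Longrightarrow> s (x i) = y i"
    by (auto simp: pairwise_insert)
  have s_form: "form (s p) (s r) = form p r" for p r
    using s by (simp add: isometry_def)
  have "c k dvd form (s (x k)) z" for z
  proof -
    obtain z' where "z = s z'"
      using s by (meson isometry_def bij_is_surj surjE)
    then show ?thesis using insert.prems s_form by simp
  qed
  then obtain t where t: "isometry t" and tk: "t (s (x k)) = y k"
    and t_fix: "\<And>z. form (s (x k)) z = 0 \<Longrightarrow> form (y k) z = 0 \<Longrightarrow> t z = z"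
    using exists_isometry_moving_vector[of "s (x k)" "c k" "y k"] insert.prems s_form
    by (metis insertI1)
  have "t (s (x i)) = y i" if i: "i \<in> I" for i
  proof -
    have "i \<noteq> k" using i insert.hyps by blast
    then have "form (x k) (x i) = 0" "form (y k) (y i) = 0"
      using i insert.prems(6,7) by (auto simp: pairwise_insert)
    then have "t (y i) = y i"
      using t_fix[of "y i"] s_form[of "x k" "x i"] sx[OF i] by simp
    then show ?thesis by (simp add: sx i)
  qed
  then have "\<forall>i\<in>insert k I. (t \<circ> s) (x i) = y i"
    using tk by simp
  then show ?case
    using isometry_comp[OF t s] by blast
qed

end

section \<open>Cancellation\<close>

lemma (in R_lattice) symmetric_form: "symmetric_form scale form"
  by (intro symmetric_form.intro symmetric_form_axioms.intro module_axioms form_sym form_hom)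

lemma symmetric_form_orth_sum:
  assumes "symmetric_form sM bM" and "symmetric_form sL bL"
  shows "symmetric_form (module_prod.scale sM sL) (orth_sum_form bM bL)"
proof -
  interpret M: symmetric_form sM bM by fact
  interpret L: symmetric_form sL bL by fact
  interpret module_prod sM sL ..
  show ?thesis
  proof
    show "orth_sum_form bM bL x y = orth_sum_form bM bL y x" for x y
      by (simp add: orth_sum_form_def M.form_sym[of "fst x"] L.form_sym[of "snd x"])
  qed (simp_all add: orth_sum_form_def scale_def M.form_simps L.form_simps algebra_simps)
qed

theorem corollary2p5:
  fixes v :: "'r::idom fract \<Rightarrow> 'g::linordered_ab_group_add"
    and sM :: "'r \<Rightarrow> 'm::ab_group_add \<Rightarrow> 'm" and bM :: "'m \<Rightarrow> 'm \<Rightarrow> 'r"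
    and sN :: "'r \<Rightarrow> 'n::ab_group_add \<Rightarrow> 'n" and bN :: "'n \<Rightarrow> 'n \<Rightarrow> 'r"
    and sL :: "'r \<Rightarrow> 'l::ab_group_add \<Rightarrow> 'l" and bL :: "'l \<Rightarrow> 'l \<Rightarrow> 'r"
  assumes "two_henselian_valuation_ring v"
    and "(2::'r) dvd 1"
    and "R_lattice sM bM" and "R_lattice sN bN" and "R_lattice sL bL"
    and "lattice_iso
           (module_prod.scale sM sL) (orth_sum_form bM bL)
           (module_prod.scale sN sL) (orth_sum_form bN bL)"
  shows "lattice_iso sM bM sN bN"
proof -
  interpret two_henselian_valuation_ring v by fact
  interpret M: R_lattice sM bM by fact
  interpret N: R_lattice sN bN by fact
  interpret L: R_lattice sL bL by fact
  interpret M: symmetric_form sM bM by (rule M.symmetric_form)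
  interpret N: symmetric_form sN bN by (rule N.symmetric_form)
  interpret L: symmetric_form sL bL by (rule L.symmetric_form)
  interpret L: chain_ring_form sL bL
    using dvd_total \<open>2 dvd 1\<close> by unfold_locales
  interpret MP: module_prod sM sL ..
  interpret NP: module_prod sN sL ..
  interpret NL: symmetric_form NP.scale "orth_sum_form bN bL"
    by (intro symmetric_form_orth_sum N.symmetric_form L.symmetric_form)
  interpret NL: chain_ring_form NP.scale "orth_sum_form bN bL"
    using dvd_total \<open>2 dvd 1\<close> by unfold_locales
  obtain \<phi> where \<phi>: "module_hom MP.scale NP.scale \<phi>" "bij \<phi>"
      "\<And>x y. orth_sum_form bN bL (\<phi> x) (\<phi> y) = orth_sum_form bM bL x y"
    using assms(6) unfolding lattice_iso_def by blast

  have nondegenerate: "x = 0" if "\<And>z. bL x z = 0" for x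
    using L.nondegenerate that by (metis L.form_zero_left ext injD)
  obtain E where E: "finite E" "L.span E = UNIV" "pairwise (\<lambda>e f. bL e f = 0) E"
    using L.free_finite_rank L.exists_orthogonal_generators by metis
  \<comment> \<open>A generator of norm zero is orthogonal to everything, hence zero by non-degeneracy; removing
    zero therefore leaves generators with nonzero norms.\<close>
  define I where "I = E - {0}"
  have "E \<subseteq> L.span I"
    using L.span_zero[of I] L.span_base[of _ I] by (auto simp: I_def)
  then have span_I: "L.span I = UNIV"
    using E(2) L.span_minimal[of E "L.span I"] by auto
  have orth_I: "bL e f = 0" if "e \<in> I" "f \<in> I" "e \<noteq> f" for e f
    using E(3) that by (auto simp: I_def pairwise_def)
  have dvd_I: "bL e e dvd bL e z" if e: "e \<in> I" for e z
  proof -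
    have "z \<in> L.span I" by (simp add: span_I)
    then show ?thesis
    proof (induction rule: L.span_induct_alt)
      case (step a f y)
      then show ?case
        using orth_I[OF e step(1)] by (cases "e = f") (auto simp: L.form_simps)
    qed (simp add: L.form_simps)
  qed
  have norm_I: "bL e e \<noteq> 0" if "e \<in> I" for e
    using dvd_I[OF that] nondegenerate[of e] that by (auto simp: I_def)

  have form_L: "orth_sum_form bM bL (0, e) x = bL e (snd x)"
      "orth_sum_form bN bL (0, e) y = bL e (snd y)" for e x y
    by (simp_all add: orth_sum_form_def M.form_simps N.form_simps)
  have "\<exists>s. NL.isometry s \<and> (\<forall>e\<in>I. s (\<phi> (0, e)) = (0, e))"
  proof (rule NL.exists_isometry_extending[where c = "\<lambda>e. bL e e"])
    show "finite I" using E by (simp add: I_def)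
    show "bL e e dvd orth_sum_form bN bL (\<phi> (0, e)) z" if "e \<in> I" for e z
    proof -
      obtain z' where "z = \<phi> z'" using \<phi>(2) by (meson bij_is_surj surjE)
      then show ?thesis
        using dvd_I[OF that] by (simp add: \<phi>(3) form_L)
    qed
    show "bL e e dvd orth_sum_form bN bL (0, e) z" if "e \<in> I" for e z
      using dvd_I[OF that] by (simp add: form_L)
  qed (auto simp: pairwise_def \<phi>(3) form_L orth_I norm_I)
  then obtain s where s: "NL.isometry s" and s_I: "\<And>e. e \<in> I \<Longrightarrow> s (\<phi> (0, e)) = (0, e)"
    by blast
  define \<psi> where "\<psi> = s \<circ> \<phi>"
  have \<psi>_hom: "module_hom MP.scale NP.scale \<psi>"
    using \<phi>(1) s unfolding \<psi>_def NL.isometry_def by (blast intro: module_hom_compose)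
  interpret \<psi>: module_hom MP.scale NP.scale \<psi> by (rule \<psi>_hom)
  have \<psi>_bij: "bij \<psi>"
    using \<phi>(2) s unfolding \<psi>_def NL.isometry_def by (blast intro: bij_comp)
  have \<psi>_form: "orth_sum_form bN bL (\<psi> x) (\<psi> y) = orth_sum_form bM bL x y" for x y
    using s by (simp add: \<psi>_def NL.isometry_def \<phi>(3) del: split_paired_All)
  have \<psi>_L: "\<psi> (0, l) = (0, l)" for l
  proof -
    have "l \<in> L.span I" by (simp add: span_I)
    then show ?thesis
    proof (induction rule: L.span_induct_alt)
      case base
      then show ?case using \<psi>.zero by (simp add: zero_prod_def)
    next
      case (step a e y)
      have "\<psi> (0, sL a e + y) = \<psi> (MP.scale a (0, e) + (0, y))"
        by (simp add: MP.scale_prod)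
      also have "\<dots> = NP.scale a (\<psi> (0, e)) + \<psi> (0, y)"
        by (simp only: \<psi>.add \<psi>.scale)
      also have "\<dots> = (0, sL a e + y)"
        using step s_I[of e] by (simp add: \<psi>_def NP.scale_prod)
      finally show ?case .
    qed
  qed
  have snd_\<psi>: "snd (\<psi> (m, 0)) = 0" for m
  proof (rule nondegenerate)
    fix l
    show "bL (snd (\<psi> (m, 0))) l = 0"
      using \<psi>_form[of "(m, 0)" "(0, l)"]
      by (simp add: \<psi>_L) (simp add: orth_sum_form_def M.form_simps N.form_simps L.form_simps)
  qed
  define \<chi> where "\<chi> m = fst (\<psi> (m, 0))" for m
  have \<psi>_M: "\<psi> (m, 0) = (\<chi> m, 0)" for m
    by (simp add: \<chi>_def prod_eq_iff snd_\<psi>)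
  have "module_hom sM sN \<chi>"
    unfolding module_hom_iff
  proof (intro conjI allI)
    show "\<chi> (x + y) = \<chi> x + \<chi> y" for x y
      using \<psi>.add[of "(x, 0)" "(y, 0)"] by (simp add: \<chi>_def)
    show "\<chi> (sM a x) = sN a (\<chi> x)" for a x
      using \<psi>.scale[of a "(x, 0)"] by (simp add: \<chi>_def MP.scale_prod NP.scale_def)
  qed (rule M.module_axioms N.module_axioms)+
  moreover have "inj \<chi>"
  proof (rule injI)
    fix x y assume "\<chi> x = \<chi> y"
    then have "\<psi> (x, 0) = \<psi> (y, 0)" by (simp add: \<psi>_M)
    then show "x = y" using \<psi>_bij by (auto simp: bij_def dest: injD)
  qed
  moreover have "surj \<chi>"
  proof (unfold surj_def, rule allI)
    fix n
    obtain m l where "(n, 0) = \<psi> (m, l)"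
      using \<psi>_bij by (metis bij_is_surj surjE surj_pair)
    also have "\<dots> = \<psi> (m, 0) + \<psi> (0, l)"
      by (simp flip: \<psi>.add)
    also have "\<dots> = (\<chi> m, l)"
      by (simp add: \<psi>_M \<psi>_L)
    finally show "\<exists>m. n = \<chi> m" by auto
  qed
  moreover have "bN (\<chi> x) (\<chi> y) = bM x y" for x y
    using \<psi>_form[of "(x, 0)" "(y, 0)"]
    by (simp add: \<psi>_M) (simp add: orth_sum_form_def L.form_simps)
  ultimately show ?thesis
    unfolding lattice_iso_def bij_def by blast
qed

end
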